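(* Let $n\ge 1$, let $\Pi:\mathbb{R}^n\to\mathbb{R}$ be a polynomial function, let $c>0$, $r>\sqrt{n}$, and let $\varepsilon>0$ be fixed. Let $J_\varepsilon$ be the functional $$V\mapsto \frac{1}{4\varepsilon}\|V\circ V-\mathbf{1}\|_2^2+\frac{c}{2}\|V\|_2^2+\Pi(V)$$ on $\mathbb{R}^n$. Let $U_\varepsilon$ be a minimizer of $J_\varepsilon$ over the set $\overline{B}(0;r)$, and denote by $\delta$ the Euclidean distance from $U_\varepsilon$ to the set $\{\pm1\}^n$. Then $$\delta\le \frac{4\varepsilon}{1+2c\varepsilon}\left(c\sqrt{n}+\max_{V\in\overline{B}(0;r)}\|\nabla\Pi(V)\|_2\right).$$
   Context: $V\circ V=(v_i^2)_{i=1}^n$ is the Hadamard (componentwise) product, $\mathbf{1}=(1,\dots,1)\in\mathbb{R}^n$, $\|\cdot\|_2$ is the Euclidean norm, and $\overline{B}(0;r)$ is the closed Euclidean ball of radius $r$ centered at the origin of $\mathbb{R}^n$. *)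

theory Defs
  imports "HOL-Analysis.Analysis"
begin

definition gradient :: "('a::real_inner \<Rightarrow> real) \<Rightarrow> 'a \<Rightarrow> 'a"
  where "gradient f x = (THE D. GDERIV f x :> D)"

text \<open>On \<open>real ^ 'n\<close>, the type-class operation \<open>*\<close> is the componentwise (Hadamard) product,
  \<open>1\<close> is the all-ones vector, and \<open>norm\<close> is the Euclidean norm.\<close>

definition J :: "real \<Rightarrow> real \<Rightarrow> (real ^ 'n \<Rightarrow> real) \<Rightarrow> real ^ 'n \<Rightarrow> real"
  where "J \<epsilon> c P V =
    1 / (4 * \<epsilon>) * (norm (V * V - 1))\<^sup>2 + c / 2 * (norm V)\<^sup>2 + P V"

definition sign_vectors :: "(real ^ 'n) set"
  where "sign_vectors = {W. \<forall>i. W $ i \<in> {1, -1}}"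

text \<open>\<open>Max\<close> is only meaningful for finite sets, so the maximum over an arbitrary set is taken as
  the greatest element of the image; it is unspecified when the maximum is not attained.\<close>

definition max_over :: "('a \<Rightarrow> real) \<Rightarrow> 'a set \<Rightarrow> real"
  where "max_over f S = (GREATEST m. m \<in> f ` S)"

end

theory Submission
  imports Defs
begin

text \<open>
  Rounding each component of the minimizer \<open>U\<close> to \<open>1\<close> or \<open>-1\<close> according to its sign
  (zero to \<open>1\<close>) gives a sign vector \<open>W\<close> of norm \<open>sqrt n < r\<close>, so \<open>W\<close> is an admissible competitor and
  \<open>J U \<le> J W\<close>. Put \<open>d = norm (U - W)\<close>, an upper bound for \<open>\<delta>\<close>. Three estimates turn this
  comparison into a quadratic inequality for \<open>d\<close>.

  The double-well term vanishes at \<open>W\<close> and is coercive at \<open>U\<close>: since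
  \<open>\<bar>u\<^sup>2 - 1\<bar> = \<bar>\<bar>u\<bar> - 1\<bar> (\<bar>u\<bar> + 1) \<ge> \<bar>\<bar>u\<bar> - 1\<bar>\<close>, it is at least \<open>d\<^sup>2 / (4 * \<epsilon>)\<close>
  (\<open>norm_diff_sign_rounding_le\<close>). The quadratic term changes by \<open>c / 2\<close> times
  \<open>(norm U)\<^sup>2 - (norm W)\<^sup>2 = d\<^sup>2 + 2 * (W \<bullet> (U - W)) \<ge> d\<^sup>2 - 2 * sqrt n * d\<close>. Finally
  \<open>P W - P U \<le> M * d\<close> by the mean value inequality on the convex ball, where \<open>M\<close> is the maximum
  of the norm of the gradient; the maximum is attained because the gradient of a polynomial is
  continuous (\<open>real_polynomial_function_continuous_gradient\<close>). Altogether
  \<open>(1 / (4 * \<epsilon>) + c / 2) * d\<^sup>2 \<le> (c * sqrt n + M) * d\<close>, and dividing by \<open>d\<close> gives the bound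
  if \<open>d > 0\<close>; if \<open>d = 0\<close> the bound is clear from \<open>M \<ge> 0\<close>.
\<close>

lemma gradient_eq:
  assumes "GDERIV f x :> D"
  shows "gradient f x = D"
  unfolding gradient_def
proof (rule the_equality)
  fix E
  assume "GDERIV f x :> E"
  then have "(\<lambda>h. h \<bullet> E) = (\<lambda>h. h \<bullet> D)"
    using assms has_derivative_unique unfolding gderiv_def by blast
  then show "E = D"
    by (metis vector_eq_ldot)
qed (rule assms)

text \<open>Induction over the polynomial structure, carrying continuity of the gradient field along
  with its existence: linear functions have constant gradient by Riesz representation, and the sum
  and product rules preserve continuity.\<close>

lemma real_polynomial_function_continuous_gradient:
  fixes p :: "'a::euclidean_space \<Rightarrow> real"
  assumes "real_polynomial_function p"
  shows "\<exists>G. continuous_on UNIV G \<and> (\<forall>x. GDERIV p x :> G x)"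
  using assms
proof (induction rule: real_polynomial_function.induct)
  case (linear f)
  define g where "g = (\<Sum>b\<in>Basis. f b *\<^sub>R b)"
  have "f = (\<lambda>h. h \<bullet> g)"
  proof
    fix h :: 'a
    have "f h = f (\<Sum>b\<in>Basis. (h \<bullet> b) *\<^sub>R b)"
      by (simp add: euclidean_representation)
    also have "\<dots> = (\<Sum>b\<in>Basis. (h \<bullet> b) * f b)"
      using bounded_linear.linear[OF linear] by (simp add: linear_sum linear_scale)
    finally show "f h = h \<bullet> g"
      by (simp add: g_def inner_sum_right mult.commute)
  qed
  then have "\<forall>x. GDERIV f x :> g"
    using bounded_linear_imp_has_derivative[OF linear] by (simp add: gderiv_def)
  then show ?case
    by (intro exI[of _ "\<lambda>_. g"]) simp
next
  case (const c)
  show ?case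
    by (intro exI[of _ "\<lambda>_. 0"]) (simp add: GDERIV_const)
next
  case (add f g)
  then obtain F G where "continuous_on UNIV F" "\<forall>x. GDERIV f x :> F x"
    "continuous_on UNIV G" "\<forall>x. GDERIV g x :> G x"
    by blast
  then show ?case
    by (intro exI[of _ "\<lambda>x. F x + G x"]) (auto intro: continuous_on_add GDERIV_add)
next
  case (mult f g)
  then obtain F G where FG: "continuous_on UNIV F" "\<forall>x. GDERIV f x :> F x"
    "continuous_on UNIV G" "\<forall>x. GDERIV g x :> G x"
    by blast
  moreover have "continuous_on UNIV f" "continuous_on UNIV g"
    using mult.hyps by (auto intro: continuous_on_polymonial_function simp: real_polynomial_function_eq)
  ultimately show ?case
    by (intro exI[of _ "\<lambda>x. f x *\<^sub>R G x + g x *\<^sub>R F x"])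
      (auto intro!: continuous_intros GDERIV_mult)
qed

lemma le_max_over:
  assumes "compact S" "continuous_on S f" "x \<in> S"
  shows "f x \<le> max_over f S"
proof -
  obtain y where y: "y \<in> S" "\<forall>z\<in>S. f z \<le> f y"
    using continuous_attains_sup[OF assms(1) _ assms(2)] assms(3) by blast
  then have "max_over f S = f y"
    unfolding max_over_def by (intro Greatest_equality) auto
  then show ?thesis
    using y assms(3) by simp
qed

lemma norm_gradient_le_max_over:
  fixes P :: "'a::euclidean_space \<Rightarrow> real"
  assumes "real_polynomial_function P" "compact S" "x \<in> S"
  shows "norm (gradient P x) \<le> max_over (\<lambda>V. norm (gradient P V)) S"
proof -
  obtain G where G: "continuous_on UNIV G" "\<forall>x. GDERIV P x :> G x"
    using real_polynomial_function_continuous_gradient[OF assms(1)] by blast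
  have "gradient P = G"
    using G(2) by (auto intro: gradient_eq)
  then have "continuous_on S (\<lambda>V. norm (gradient P V))"
    using G(1) continuous_on_subset by (blast intro: continuous_on_norm)
  then show ?thesis
    by (rule le_max_over[OF assms(2) _ assms(3)])
qed

lemma polynomial_diff_le_max_gradient:
  fixes P :: "'a::euclidean_space \<Rightarrow> real"
  assumes P: "real_polynomial_function P" and S: "compact S" "convex S" and "x \<in> S" "y \<in> S"
  shows "P x - P y \<le> max_over (\<lambda>V. norm (gradient P V)) S * norm (x - y)"
    (is "_ \<le> ?M * _")
proof -
  have deriv: "(P has_derivative (\<lambda>h. h \<bullet> gradient P z)) (at z within S)" for z
    using real_polynomial_function_continuous_gradient[OF P]
    by (metis gradient_eq gderiv_def has_derivative_at_withinI)
  have "onorm (\<lambda>h. h \<bullet> gradient P z) \<le> ?M" if "z \<in> S" for z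
  proof (rule onorm_le)
    fix h
    have "norm (h \<bullet> gradient P z) \<le> norm (gradient P z) * norm h"
      using Cauchy_Schwarz_ineq2[of h "gradient P z"] by (simp add: mult.commute)
    also have "\<dots> \<le> ?M * norm h"
      by (intro mult_right_mono norm_gradient_le_max_over P S(1) that norm_ge_zero)
    finally show "norm (h \<bullet> gradient P z) \<le> ?M * norm h" .
  qed
  then have "norm (P x - P y) \<le> ?M * norm (x - y)"
    using differentiable_bound[OF S(2) deriv] assms(4,5) by blast
  then show ?thesis
    by simp
qed

lemma norm_vec_power2_eq_sum:
  fixes x :: "real ^ 'n"
  shows "(norm x)\<^sup>2 = (\<Sum>i\<in>UNIV. (x $ i)\<^sup>2)"
  unfolding power2_norm_eq_inner by (simp add: inner_vec_def power2_eq_square)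

lemma norm_sign_vector:
  fixes W :: "real ^ 'n"
  assumes "W \<in> sign_vectors"
  shows "norm W = sqrt (real CARD('n))"
proof -
  have "(W $ i)\<^sup>2 = 1" for i
    using assms by (auto simp: sign_vectors_def power2_eq_1_iff)
  then have "(norm W)\<^sup>2 = real CARD('n)"
    by (simp add: norm_vec_power2_eq_sum)
  then show ?thesis
    by (intro real_sqrt_unique[symmetric]) simp_all
qed

lemma sign_vector_mult_self:
  fixes W :: "real ^ 'n"
  assumes "W \<in> sign_vectors"
  shows "W * W = 1"
proof -
  have "W $ i * W $ i = 1" for i
  proof -
    have "W $ i = 1 \<or> W $ i = - 1"
      using assms by (simp add: sign_vectors_def)
    then show ?thesis
      by auto
  qed
  then show ?thesis
    by (simp add: vec_eq_iff)
qed

definition sign_rounding :: "real ^ 'n \<Rightarrow> real ^ 'n"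
  where "sign_rounding V = (\<chi> i. if V $ i \<ge> 0 then 1 else -1)"

lemma sign_rounding_in_sign_vectors: "sign_rounding V \<in> sign_vectors"
  by (simp add: sign_rounding_def sign_vectors_def)

text \<open>Coercivity of the double well. If \<open>w\<close> is the sign of \<open>v\<close> then
  \<open>v\<^sup>2 - 1 = (v - w) * (v + w)\<close> with \<open>\<bar>v + w\<bar> = \<bar>v\<bar> + 1 \<ge> 1\<close>.\<close>

lemma norm_diff_sign_rounding_le:
  fixes V :: "real ^ 'n"
  shows "(norm (V - sign_rounding V))\<^sup>2 \<le> (norm (V * V - 1))\<^sup>2"
proof -
  have "((V - sign_rounding V) $ i)\<^sup>2 \<le> ((V * V - 1) $ i)\<^sup>2" for i
  proof -
    define v w where "v = V $ i" and "w = sign_rounding V $ i"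
    have "w * w = 1" and "1 \<le> \<bar>v + w\<bar>"
      by (auto simp: v_def w_def sign_rounding_def)
    then have "\<bar>v - w\<bar> * 1 \<le> \<bar>v - w\<bar> * \<bar>v + w\<bar>"
      by (intro mult_left_mono) auto
    also have "\<dots> = \<bar>v * v - 1\<bar>"
      using \<open>w * w = 1\<close> by (simp add: abs_mult[symmetric] algebra_simps)
    finally show ?thesis
      by (simp add: v_def w_def abs_le_square_iff)
  qed
  then show ?thesis
    unfolding norm_vec_power2_eq_sum by (intro sum_mono)
qed

theorem theorem2:
  fixes P :: "real ^ 'n \<Rightarrow> real"
    and U :: "real ^ 'n"
    and c r \<epsilon> \<delta> :: real
  assumes "real_polynomial_function P"
    and "c > 0"
    and "r > sqrt (real CARD('n))"
    and "\<epsilon> > 0"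
    and "is_arg_min (J \<epsilon> c P) (\<lambda>V. V \<in> cball 0 r) U"
    and "\<delta> = infdist U sign_vectors"
  shows "\<delta> \<le> 4 * \<epsilon> / (1 + 2 * c * \<epsilon>) *
    (c * sqrt (real CARD('n)) + max_over (\<lambda>V. norm (gradient P V)) (cball 0 r))"
proof -
  define s where "s = sqrt (real CARD('n))"
  define M where "M = max_over (\<lambda>V. norm (gradient P V)) (cball (0 :: real ^ 'n) r)"
  define W where "W = sign_rounding U"
  define d where "d = norm (U - W)"
  have W: "W \<in> sign_vectors" "norm W = s"
    by (simp_all add: W_def s_def sign_rounding_in_sign_vectors norm_sign_vector)
  have balls: "U \<in> cball 0 r" "W \<in> cball 0 r"
    using assms(3,5) W(2) by (auto simp: is_arg_min_def s_def)
  have "\<delta> \<le> d"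
    using assms(6) infdist_le[OF W(1), of U] by (simp add: d_def dist_norm)
  have "s \<ge> 0" "d \<ge> 0"
    by (simp_all add: s_def d_def)
  have "M \<ge> 0"
    using norm_gradient_le_max_over[OF assms(1) compact_cball balls(1)] norm_ge_zero order_trans
    unfolding M_def by blast
  have minimal: "J \<epsilon> c P U \<le> J \<epsilon> c P W"
    using assms(5) balls(2) by (auto simp: is_arg_min_def not_less)
  have P_diff: "P W - P U \<le> M * d"
    using polynomial_diff_le_max_gradient[OF assms(1) compact_cball convex_cball balls(2,1)]
    by (simp add: M_def d_def norm_minus_commute)
  have quadratic: "d\<^sup>2 - 2 * s * d \<le> (norm U)\<^sup>2 - (norm W)\<^sup>2"
  proof -
    have "- (W \<bullet> (U - W)) \<le> s * d"
      using Cauchy_Schwarz_ineq2[of W "U - W"] by (simp add: W(2) d_def)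
    moreover have "(norm U)\<^sup>2 - (norm W)\<^sup>2 = d\<^sup>2 + 2 * (W \<bullet> (U - W))"
      by (simp add: d_def power2_norm_eq_inner algebra_simps inner_commute)
    ultimately show ?thesis
      by linarith
  qed
  have "1 / (4 * \<epsilon>) * d\<^sup>2 \<le> 1 / (4 * \<epsilon>) * (norm (U * U - 1))\<^sup>2"
    using assms(4) norm_diff_sign_rounding_le[of U] by (intro mult_left_mono) (auto simp: d_def W_def)
  moreover have "c / 2 * (d\<^sup>2 - 2 * s * d) \<le> c / 2 * ((norm U)\<^sup>2 - (norm W)\<^sup>2)"
    using assms(2) quadratic by (intro mult_left_mono) auto
  moreover have "1 / (4 * \<epsilon>) * (norm (U * U - 1))\<^sup>2 + c / 2 * ((norm U)\<^sup>2 - (norm W)\<^sup>2) \<le> P W - P U"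
    using minimal by (simp add: J_def sign_vector_mult_self[OF W(1)] algebra_simps)
  ultimately have "1 / (4 * \<epsilon>) * d\<^sup>2 + c / 2 * (d\<^sup>2 - 2 * s * d) \<le> M * d"
    using P_diff by linarith
  then have "d * ((1 + 2 * c * \<epsilon>) * d) \<le> d * (4 * \<epsilon> * (c * s + M))"
    using assms(4) by (simp add: field_simps power2_eq_square)
  then have "(1 + 2 * c * \<epsilon>) * d \<le> 4 * \<epsilon> * (c * s + M)"
    using \<open>d \<ge> 0\<close> \<open>s \<ge> 0\<close> \<open>M \<ge> 0\<close> assms(2,4) by (cases "d = 0") auto
  moreover have "1 + 2 * c * \<epsilon> > 0"
    using assms(2,4) by (simp add: add_pos_pos)
  ultimately have "d \<le> 4 * \<epsilon> / (1 + 2 * c * \<epsilon>) * (c * s + M)"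
    by (simp add: field_simps)
  with \<open>\<delta> \<le> d\<close> show ?thesis
    by (simp add: s_def M_def)
qed

end
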